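(* There exist a Banach algebra $A$ which is not nil and a Banach $A$-bimodule $X$ such that $JMul_{2}(A,X)\subsetneq JMul_{3}(A,X)$.
   Context: A Banach algebra $A$ is nil if there is $n\in\mathbb{N}$ with $a^n=0$ for all $a\in A$. A bounded linear map $J:A\to X$ is an $n$-Jordan multiplier if $J(a^n)=a\cdot J(a^{n-1})=J(a^{n-1})\cdot a$ for all $a\in A$; $JMul_n(A,X)$ is the set of these. *)

theory Defs
  imports "HOL-Analysis.Analysis"
begin

text \<open>Complex Banach spaces are modelled concretely as the (complete, normed)
  spaces complex^'n; complex scalar multiplication is the componentwise
  product c *s v.\<close>

definition bounded_clinear_map :: "(complex^'n \<Rightarrow> complex^'m) \<Rightarrow> bool" where
  "bounded_clinear_map f \<longleftrightarrow>
     (\<forall>x y. f (x + y) = f x + f y) \<and> (\<forall>c x. f (c *s x) = c *s f x) \<and>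
     (\<exists>K. \<forall>x. norm (f x) \<le> K * norm x)"

definition bounded_cbilinear_map :: "('u::real_normed_vector \<Rightarrow> 'v::real_normed_vector \<Rightarrow> complex^'w) \<Rightarrow>
    ((complex \<Rightarrow> 'u \<Rightarrow> 'u)) \<Rightarrow> ((complex \<Rightarrow> 'v \<Rightarrow> 'v)) \<Rightarrow> bool" where
  "bounded_cbilinear_map f su sv \<longleftrightarrow>
     (\<forall>a b x. f (a + b) x = f a x + f b x) \<and> (\<forall>a x y. f a (x + y) = f a x + f a y) \<and>
     (\<forall>c a x. f (su c a) x = c *s f a x) \<and> (\<forall>c a x. f a (sv c x) = c *s f a x) \<and>
     (\<exists>K. \<forall>a x. norm (f a x) \<le> K * norm a * norm x)"

text \<open>A complex Banach algebra (not necessarily unital) on complex^'n: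
  an associative, complex-bilinear multiplication with submultiplicative norm.\<close>
definition cbanach_algebra :: "(complex^'n \<Rightarrow> complex^'n \<Rightarrow> complex^'n) \<Rightarrow> bool" where
  "cbanach_algebra mul \<longleftrightarrow>
     bounded_cbilinear_map mul (*s) (*s) \<and>
     (\<forall>a b c. mul (mul a b) c = mul a (mul b c)) \<and>
     (\<forall>a b. norm (mul a b) \<le> norm a * norm b)"

text \<open>Powers a^n for n \<ge> 1 in a possibly non-unital algebra (value at 0 is a dummy).\<close>
fun apow :: "('a \<Rightarrow> 'a \<Rightarrow> 'a) \<Rightarrow> 'a \<Rightarrow> nat \<Rightarrow> 'a::zero" where
  "apow mul a 0 = 0"
| "apow mul a (Suc 0) = a"
| "apow mul a (Suc (Suc n)) = mul a (apow mul a (Suc n))"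

definition is_nil :: "(complex^'n \<Rightarrow> complex^'n \<Rightarrow> complex^'n) \<Rightarrow> bool" where
  "is_nil mul \<longleftrightarrow> (\<exists>n\<ge>1. \<forall>a. apow mul a n = 0)"

text \<open>Banach A-bimodule X = complex^'m with left action lmul and right action rmul.\<close>
definition banach_bimodule ::
  "(complex^'n \<Rightarrow> complex^'n \<Rightarrow> complex^'n) \<Rightarrow> (complex^'n \<Rightarrow> complex^'m \<Rightarrow> complex^'m)
    \<Rightarrow> (complex^'m \<Rightarrow> complex^'n \<Rightarrow> complex^'m) \<Rightarrow> bool" where
  "banach_bimodule mul lmul rmul \<longleftrightarrow>
     bounded_cbilinear_map lmul (*s) (*s) \<and> bounded_cbilinear_map rmul (*s) (*s) \<and>
     (\<forall>a b x. lmul (mul a b) x = lmul a (lmul b x)) \<and>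
     (\<forall>a b x. rmul x (mul a b) = rmul (rmul x a) b) \<and>
     (\<forall>a b x. rmul (lmul a x) b = lmul a (rmul x b))"

text \<open>n-Jordan multipliers: J(a^n) = a\<cdot>J(a^(n-1)) = J(a^(n-1))\<cdot>a.\<close>
definition JMul ::
  "(complex^'n \<Rightarrow> complex^'n \<Rightarrow> complex^'n) \<Rightarrow> (complex^'n \<Rightarrow> complex^'m \<Rightarrow> complex^'m)
    \<Rightarrow> (complex^'m \<Rightarrow> complex^'n \<Rightarrow> complex^'m) \<Rightarrow> nat \<Rightarrow> (complex^'n \<Rightarrow> complex^'m) set" where
  "JMul mul lmul rmul n = {J. bounded_clinear_map J \<and>
     (\<forall>a. J (apow mul a n) = lmul a (J (apow mul a (n - 1))) \<and>
          J (apow mul a n) = rmul (J (apow mul a (n - 1))) a)}"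

end

theory Submission
  imports Defs
begin

text \<open>Take \<open>A = \<complex>\<^sup>3\<close> with \<open>a \<cdot> b = (a\<^sub>1 b\<^sub>1, 0, a\<^sub>2 b\<^sub>2)\<close>: a triple product only
  involves first coordinates, so the product is associative, and \<open>e\<^sub>1\<close> is a nonzero idempotent,
  so \<open>A\<close> is not nil. Over the zero bimodule \<open>X = \<complex>\<^sup>3\<close>, an \<open>n\<close>-Jordan multiplier is just a
  bounded linear map vanishing on \<open>n\<close>-th powers. Every cube \<open>(a\<^sub>1\<^sup>3, 0, 0)\<close> is a square, since
  \<open>\<complex>\<close> has square roots, so \<open>JMul\<^sub>2 \<subseteq> JMul\<^sub>3\<close>; but the squares also contain \<open>(0, 0, 1)\<close>,
  which no cube reaches, and \<open>x \<mapsto> (x\<^sub>3, 0, 0)\<close> lies in \<open>JMul\<^sub>3\<close> but not in \<open>JMul\<^sub>2\<close>.\<close>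

lemma apow_2: "apow mul a 2 = mul a a"
  by (simp add: numeral_2_eq_2)

lemma apow_3: "apow mul a 3 = mul a (mul a a)"
  by (simp add: numeral_3_eq_3)

lemma apow_idempotent:
  assumes "mul e e = e" and "n \<ge> 1"
  shows "apow mul e n = e"
proof -
  obtain m where "n = Suc m" using \<open>n \<ge> 1\<close> by (cases n) auto
  moreover have "apow mul e (Suc m) = e" for m
    by (induction m) (simp_all add: assms(1))
  ultimately show ?thesis by simp
qed

lemma not_is_nil_if_idempotent:
  assumes "mul e e = e" and "e \<noteq> 0"
  shows "\<not> is_nil mul"
  unfolding is_nil_def by (metis apow_idempotent assms)

lemma bounded_cbilinear_map_zero: "bounded_cbilinear_map (\<lambda>_ _. 0) su sv"
  unfolding bounded_cbilinear_map_def by (auto intro: exI[of _ 0])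

lemma banach_bimodule_zero: "banach_bimodule mul (\<lambda>_ _. 0) (\<lambda>_ _. 0)"
  unfolding banach_bimodule_def by (simp add: bounded_cbilinear_map_zero)

lemma JMul_zero_actions:
  "JMul mul (\<lambda>_ _. 0) (\<lambda>_ _. 0) n = {J. bounded_clinear_map J \<and> (\<forall>a. J (apow mul a n) = 0)}"
  unfolding JMul_def by auto

lemma JMul_zero_actions_mono:
  assumes "\<And>a. \<exists>b. apow mul a m = apow mul b n"
  shows "JMul mul (\<lambda>_ _. 0) (\<lambda>_ _. 0) n \<subseteq> JMul mul (\<lambda>_ _. 0) (\<lambda>_ _. 0) m"
proof (clarsimp simp: JMul_zero_actions)
  fix J a
  assume "\<forall>b. J (apow mul b n) = 0"
  moreover obtain b where "apow mul a m = apow mul b n" using assms by blast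
  ultimately show "J (apow mul a m) = 0" by simp
qed

lemma vec3_eq_iff: "(x::'a^3) = y \<longleftrightarrow> x$1 = y$1 \<and> x$2 = y$2 \<and> x$3 = y$3"
  by (auto simp: vec_eq_iff forall_3)

lemma norm_vec3_squared:
  "(norm (x::'a::real_normed_vector^3))\<^sup>2 = (norm (x$1))\<^sup>2 + (norm (x$2))\<^sup>2 + (norm (x$3))\<^sup>2"
  unfolding norm_vec_def L2_set_def by (simp add: sum_3 sum_nonneg)

definition alg_mul :: "complex^3 \<Rightarrow> complex^3 \<Rightarrow> complex^3" where
  "alg_mul a b = vector [a$1 * b$1, 0, a$2 * b$2]"

lemma norm_alg_mul: "norm (alg_mul a b) \<le> norm a * norm b"
proof -
  have "(norm (alg_mul a b))\<^sup>2 = (cmod (a$1))\<^sup>2 * (cmod (b$1))\<^sup>2 + (cmod (a$2))\<^sup>2 * (cmod (b$2))\<^sup>2"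
    by (simp add: norm_vec3_squared alg_mul_def norm_mult power_mult_distrib)
  also have "\<dots> \<le> ((cmod (a$1))\<^sup>2 + (cmod (a$2))\<^sup>2 + (cmod (a$3))\<^sup>2) *
                   ((cmod (b$1))\<^sup>2 + (cmod (b$2))\<^sup>2 + (cmod (b$3))\<^sup>2)"
    by (simp add: algebra_simps add_nonneg_nonneg mult_nonneg_nonneg)
  also have "\<dots> = (norm a * norm b)\<^sup>2"
    by (simp add: norm_vec3_squared power_mult_distrib)
  finally show ?thesis
    by (meson norm_ge_zero mult_nonneg_nonneg power2_le_imp_le)
qed

lemma cbanach_algebra_alg_mul: "cbanach_algebra alg_mul"
proof -
  have "bounded_cbilinear_map alg_mul (*s) (*s)"
    unfolding bounded_cbilinear_map_def
  proof (intro conjI exI allI)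
    show "norm (alg_mul a x) \<le> 1 * norm a * norm x" for a x
      using norm_alg_mul by simp
  qed (simp_all add: alg_mul_def vec3_eq_iff algebra_simps)
  moreover have "alg_mul (alg_mul a b) c = alg_mul a (alg_mul b c)" for a b c
    by (simp add: alg_mul_def vec3_eq_iff)
  ultimately show ?thesis
    unfolding cbanach_algebra_def using norm_alg_mul by blast
qed

lemma not_is_nil_alg_mul: "\<not> is_nil alg_mul"
  by (rule not_is_nil_if_idempotent[of _ "vector [1, 0, 0]"])
     (simp_all add: alg_mul_def vec3_eq_iff)

lemma alg_mul_cube_is_square:
  "alg_mul a (alg_mul a a) = alg_mul b b" if "b = vector [csqrt ((a$1)^3), 0, 0]"
  using that by (simp add: alg_mul_def vec3_eq_iff power3_eq_cube power2_eq_square[symmetric])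

definition J_third :: "complex^3 \<Rightarrow> complex^3" where
  "J_third x = vector [x$3, 0, 0]"

lemma bounded_clinear_map_J_third: "bounded_clinear_map J_third"
  unfolding bounded_clinear_map_def
proof (intro conjI exI allI)
  fix x :: "complex^3"
  have "(norm (J_third x))\<^sup>2 = (cmod (x$3))\<^sup>2"
    by (simp add: J_third_def norm_vec3_squared)
  then have "norm (J_third x) = cmod (x$3)"
    by (simp add: power2_eq_iff_nonneg)
  then show "norm (J_third x) \<le> 1 * norm x"
    using Finite_Cartesian_Product.norm_nth_le[of x 3] by simp
qed (simp_all add: J_third_def vec3_eq_iff)

lemma JMul_alg_mul_2_psubset_3:
  "JMul alg_mul (\<lambda>_ _. 0 :: complex^3) (\<lambda>_ _. 0) 2 \<subset> JMul alg_mul (\<lambda>_ _. 0) (\<lambda>_ _. 0) 3"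
    (is "?JMul 2 \<subset> ?JMul 3")
proof -
  have "?JMul 2 \<subseteq> ?JMul 3"
    by (rule JMul_zero_actions_mono) (metis apow_2 apow_3 alg_mul_cube_is_square)
  moreover have "J_third \<in> ?JMul 3"
    by (simp add: JMul_zero_actions bounded_clinear_map_J_third apow_3
                  J_third_def alg_mul_def vec3_eq_iff)
  moreover have "J_third \<notin> ?JMul 2"
  proof -
    have "J_third (apow alg_mul (vector [0, 1, 0]) 2) \<noteq> 0"
      by (simp add: apow_2 J_third_def alg_mul_def vec3_eq_iff)
    then show ?thesis
      unfolding JMul_zero_actions by blast
  qed
  ultimately show ?thesis by blast
qed

theorem mainTheorem16:
  shows "\<exists>(mul :: complex^3 \<Rightarrow> complex^3 \<Rightarrow> complex^3)
            (lmul :: complex^3 \<Rightarrow> complex^3 \<Rightarrow> complex^3)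
            (rmul :: complex^3 \<Rightarrow> complex^3 \<Rightarrow> complex^3).
           cbanach_algebra mul \<and> \<not> is_nil mul \<and> banach_bimodule mul lmul rmul \<and>
           JMul mul lmul rmul 2 \<subset> JMul mul lmul rmul 3"
  using cbanach_algebra_alg_mul not_is_nil_alg_mul banach_bimodule_zero JMul_alg_mul_2_psubset_3
  by blast

end
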